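(* Let $n=2$, let $f=f_b-f_{b+1}$, and let $\mathcal{D}'=I$ be an interval of the real line, with $\tilde f$, $\tilde{\mathcal{D}}$, $\mathcal{D}'$, $h$ as defined in the context. If $S_{\mathcal{D}}(f)$ is convex, then $S_{\tilde{\mathcal{D}}}(\tilde f)=\mathcal{R}_{qmod}^{I}(\tilde x_1-h)$, and hence $S_{\mathcal{D}}(f)=\mathfrak{p}^{-1}\big(\mathcal{R}_{qmod}^{I}(\tilde x_1-h)\big)$. (The lifted set $\mathcal{R}_{qmod}^I(\tilde x_1-h)$, whose order $N$ is taken sufficiently large, is identified with its projection to the $(\tilde x_1,\tilde x_2)$-plane; the last equality is understood at points with $x_1>0$, where $\mathfrak{p}$ is defined.)
   Context: Let $\mathcal{D}=\{x\in\mathbb{R}^2:g_1(x)\ge0,\dots,g_m(x)\ge0\}$ be a convex domain defined by polynomials, $S_{\mathcal{D}}(f)=\{x\in\mathcal{D}:f(x)\ge0\}\subset\mathbb{R}_+\times\mathbb{R}$ with nonempty interior and containing the origin, where $f(0)=0$, $\nabla f(0)=0$, and the Laurent expansion of $f$ around the origin has exactly two consecutive homogeneous parts: $f=f_b-f_{b+1}$, with $f_k$ homogeneous of degree $k$. The perspective transformation is $\mathfrak{p}(x_1,x_2)=(1/x_1,x_2/x_1)$ for $x_1>0$, with new coordinates $\tilde x_1=1/x_1$, $\tilde x_2=x_2/x_1$. Put $\tilde f_0(\tilde x_2)=f_b(1,\tilde x_2)$, $\tilde f_1(\tilde x_2)=f_{b+1}(1,\tilde x_2)$ and $\tilde f(\tilde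 x)=\tilde f_0(\tilde x_2)-\tilde f_1(\tilde x_2)/\tilde x_1$. Put $\tilde g_i(\tilde x)=g_i(x)/x_1^{\deg g_i}$ (a polynomial in $\tilde x$), $\tilde{\mathcal{D}}=\{\tilde x\in\mathbb{R}^2:\tilde g_i(\tilde x)\ge0,\ 1\le i\le m\}$, and $S_{\tilde{\mathcal{D}}}(\tilde f)=\{\tilde x\in\tilde{\mathcal{D}}:\tilde f(\tilde x)\ge0\}$, which is the image of $S_{\mathcal{D}}(f)$ (restricted to $x_1>0$) under $\mathfrak{p}$. $\mathcal{D}'\subset\mathbb{R}$ is the intersection of $\{\tilde x_2:\tilde f_0(\tilde x_2)\ge0\}$ with the projection of $\tilde{\mathcal{D}}$ onto the $\tilde x_2$-axis, and $h(\tilde x_2)=\tilde f_1(\tilde x_2)/\tilde f_0(\tilde x_2)$. In this setting $S_{\tilde{\mathcal{D}}}(\tilde f)$ is the epigraph of $h$ over $\mathcal{D}'$, i.e. $S_{\tilde{\mathcal{D}}}(\tilde f)=\{(\tilde x_1,\tilde x_2):\tilde x_2\in\mathcal{D}',\ \tilde x_1\ge h(\tilde x_2)\}$ (points $\tilde x_2$ at which the denominator of $h$ vanishes being handled by taking the closure of the part over $int(\mathcal{D}')$). Definition of $\mathcal{R}_{qmod}^I(t-h)$ for a univariate rational function $h=q/p$ in the variable $s$ (here $s=\tilde x_2$, $t=\tilde x_1$), $p$ nonnegative on the interval $I$ and positive in its interior: $I$ is described by $\gamma_1=s-a\ge0$ if it has a finite left endpoint $a$ and $\gamma_2=b_0-s\ge0$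 if it has a finite right endpoint $b_0$; $\gamma_0=1$. Fix an integer $N$ with $\deg p+1\le2N$, $\deg q\le2N$. Set $\delta_0=0$, $\delta_1=\delta_2=1$, $\mathfrak{m}_k(s)=(1,s,\dots,s^k)^T$. By division by $p$ write, for each index $i$ that occurs, $\frac{\gamma_i(s)}{p(s)}\mathfrak{m}_{N-\delta_i}(s)\mathfrak{m}_{N-\delta_i}(s)^T=\sum_{0\le\alpha\le2N-\deg p}Q^{(i)}_\alpha s^\alpha+\sum_{0\le\beta<\deg p}P^{(i)}_\beta\frac{s^\beta}{p(s)}$ and $h(s)=\sum_{0\le\alpha\le2N-\deg p}h^{(1)}_\alpha s^\alpha+\sum_{0\le\beta<\deg p}h^{(2)}_\beta\frac{s^\beta}{p(s)}$. Then $\mathcal{R}_{qmod}^I(t-h)$ is the set of $(y,z,t)$ with $y_0=1$, $t-\sum_\alpha h^{(1)}_\alpha y_\alpha-\sum_\beta h^{(2)}_\beta z_\beta\ge0$ and $\sum_\alpha Q^{(i)}_\alpha y_\alpha+\sum_\beta P^{(i)}_\beta z_\beta\succeq0$ for every occurring $i$; its projection is $\{(t,s):s=y_1\}$.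
   Formalization: The fraction q/p representing h is required to have no common zero of p and q in I (automatic in lowest terms); for example with h=(s+s^3)/s on [0,∞) left unreduced, the stated equality fails at the endpoint s=0. *)

theory Defs
  imports "HOL-Analysis.Analysis" "HOL-Computational_Algebra.Polynomial"
begin

section \<open>Bivariate polynomials\<close>

text \<open>
  A polynomial \<open>G\<close> in \<open>(x\<^sub>1, x\<^sub>2)\<close> has type \<open>real poly poly\<close>: the outer variable is \<open>x\<^sub>2\<close>, the
  inner one is \<open>x\<^sub>1\<close>, so the coefficient of \<open>x\<^sub>1^i * x\<^sub>2^j\<close> is \<open>coeff (coeff G j) i\<close>.
\<close>

definition eval2 :: "real poly poly \<Rightarrow> real \<times> real \<Rightarrow> real" where
  "eval2 G x = poly (poly G [:snd x:]) (fst x)"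

definition total_degree :: "real poly poly \<Rightarrow> nat" where
  "total_degree G = Max (insert 0 {i + j |i j. coeff (coeff G j) i \<noteq> 0})"

definition homogeneous :: "nat \<Rightarrow> real poly poly \<Rightarrow> bool" where
  "homogeneous k G \<longleftrightarrow> (\<forall>i j. coeff (coeff G j) i \<noteq> 0 \<longrightarrow> i + j = k)"

text \<open>The univariate polynomial \<open>G(1, s)\<close> in \<open>s\<close>.\<close>

definition dehom :: "real poly poly \<Rightarrow> real poly" where
  "dehom G = map_poly (\<lambda>c. poly c 1) G"


section \<open>Semialgebraic sets and the perspective transformation\<close>

definition dom_set :: "nat \<Rightarrow> (nat \<Rightarrow> real poly poly) \<Rightarrow> (real \<times> real) set" where
  "dom_set m g = {x. \<forall>i\<in>{1..m}. 0 \<le> eval2 (g i) x}"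

definition S_set :: "(real \<times> real) set \<Rightarrow> real poly poly \<Rightarrow> (real \<times> real) set" where
  "S_set D f = {x \<in> D. 0 \<le> eval2 f x}"

definition persp :: "real \<times> real \<Rightarrow> real \<times> real" where
  "persp x = (1 / fst x, snd x / fst x)"

text \<open>
  The polynomial \<open>g(x) / x\<^sub>1 ^ deg g\<close> in the new coordinates \<open>(1/x\<^sub>1, x\<^sub>2/x\<^sub>1)\<close>; as a polynomial it is
  defined on the whole plane (see \<open>persp_poly_persp\<close> below).
\<close>

definition persp_poly :: "real poly poly \<Rightarrow> real \<times> real \<Rightarrow> real" where
  "persp_poly G x =
     (\<Sum>j\<le>degree G. \<Sum>i\<le>degree (coeff G j).
        coeff (coeff G j) i * fst x ^ (total_degree G - (i + j)) * snd x ^ j)"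

definition persp_dom :: "nat \<Rightarrow> (nat \<Rightarrow> real poly poly) \<Rightarrow> (real \<times> real) set" where
  "persp_dom m g = {x. \<forall>i\<in>{1..m}. 0 \<le> persp_poly (g i) x}"

definition persp_fun :: "real poly poly \<Rightarrow> real poly poly \<Rightarrow> real \<times> real \<Rightarrow> real" where
  "persp_fun fb fb1 x = poly (dehom fb) (snd x) - poly (dehom fb1) (snd x) / fst x"

text \<open>
  The transformed function has a pole on \<open>fst x = 0\<close>, and the perspective transformation takes
  values in \<open>fst x > 0\<close>; the transformed set lives in that open half-plane
  (see \<open>persp_image\<close> below).
\<close>

definition persp_S ::
    "(real \<times> real) set \<Rightarrow> real poly poly \<Rightarrow> real poly poly \<Rightarrow> (real \<times> real) set" where
  "persp_S D fb fb1 = {x \<in> D. 0 < fst x \<and> 0 \<le> persp_fun fb fb1 x}"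

definition base_set :: "(real \<times> real) set \<Rightarrow> real poly poly \<Rightarrow> real set" where
  "base_set D fb = {s. 0 \<le> poly (dehom fb) s} \<inter> snd ` D"

text \<open>
  The epigraph, written as pairs \<open>(t, s)\<close> with \<open>t \<ge> q s / p s\<close>, of the rational function \<open>q/p\<close>
  over \<open>I\<close>. Over a zero of the denominator the fibre is that of the closure of the part
  over the interior of \<open>I\<close>.
\<close>

definition rat_epigraph :: "real set \<Rightarrow> real poly \<Rightarrow> real poly \<Rightarrow> (real \<times> real) set" where
  "rat_epigraph I q p =
     {(t, s). s \<in> I \<and> poly p s \<noteq> 0 \<and> poly q s / poly p s \<le> t} \<union>
     {(t, s). s \<in> I \<and> poly p s = 0 \<and>
        (t, s) \<in> closure {(t', s'). s' \<in> interior I \<and> poly p s' \<noteq> 0 \<and>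
                            poly q s' / poly p s' \<le> t'}}"


section \<open>The semidefinite relaxation\<close>

text \<open>
  \<open>q/p\<close> is a representation of the rational function \<open>u/v\<close> that is admissible on \<open>I\<close>:
  \<open>p\<close> is nonnegative on \<open>I\<close> and positive in its interior, and \<open>p\<close> and \<open>q\<close> have no common zero
  in \<open>I\<close> (which holds for every representation in lowest terms). The last condition matters
  only at endpoints: with \<open>q/p = (s + s^3)/s\<close> on \<open>[0, \<infinity>)\<close> the semidefinite constraint
  forces \<open>y\<^sub>1 > 0\<close>, and the point \<open>(1, 0)\<close> of the closed epigraph of \<open>1 + s^2\<close> is lost.
\<close>

definition represents_on ::
    "real set \<Rightarrow> real poly \<Rightarrow> real poly \<Rightarrow> real poly \<Rightarrow> real poly \<Rightarrow> bool" where
  "represents_on I q p u v \<longleftrightarrow>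
     p \<noteq> 0 \<and> q * v = u * p \<and>
     (\<forall>s\<in>I. 0 \<le> poly p s) \<and> (\<forall>s\<in>interior I. 0 < poly p s) \<and>
     (\<forall>s\<in>I. \<not> (poly p s = 0 \<and> poly q s = 0))"

text \<open>
  The indices \<open>i\<close> that occur, and the polynomials \<open>\<gamma>\<^sub>i\<close>. The interval \<open>I\<close> need not be closed;
  its finite endpoints are \<open>Inf I\<close> and \<open>Sup I\<close>.
\<close>

definition gam_idx :: "real set \<Rightarrow> nat set" where
  "gam_idx I = {0} \<union> (if bdd_below I then {1} else {}) \<union> (if bdd_above I then {2} else {})"

definition gam :: "real set \<Rightarrow> nat \<Rightarrow> real poly" where
  "gam I i = (if i = 0 then 1 else if i = 1 then [:- Inf I, 1:] else [:Sup I, -1:])"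

definition del :: "nat \<Rightarrow> nat" where
  "del i = (if i = 0 then 0 else 1)"

text \<open>
  Entry \<open>(k, l)\<close> of the coefficient matrices: the entry \<open>\<gamma>\<^sub>i * s^(k+l) / p\<close> of the localizing matrix
  is split by division with remainder, the quotient giving \<open>Q\<close> and the remainder \<open>P\<close>.
\<close>

definition Qmat :: "real set \<Rightarrow> real poly \<Rightarrow> nat \<Rightarrow> nat \<Rightarrow> nat \<Rightarrow> nat \<Rightarrow> real" where
  "Qmat I p i \<alpha> k l = coeff ((gam I i * monom 1 (k + l)) div p) \<alpha>"

definition Pmat :: "real set \<Rightarrow> real poly \<Rightarrow> nat \<Rightarrow> nat \<Rightarrow> nat \<Rightarrow> nat \<Rightarrow> real" where
  "Pmat I p i \<beta> k l = coeff ((gam I i * monom 1 (k + l)) mod p) \<beta>"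

text \<open>Positive semidefiniteness of a real matrix with rows and columns indexed by \<open>0, \<dots>, n\<close>.\<close>

definition psd :: "nat \<Rightarrow> (nat \<Rightarrow> nat \<Rightarrow> real) \<Rightarrow> bool" where
  "psd n M \<longleftrightarrow>
     (\<forall>k\<le>n. \<forall>l\<le>n. M k l = M l k) \<and>
     (\<forall>v :: nat \<Rightarrow> real. 0 \<le> (\<Sum>k\<le>n. \<Sum>l\<le>n. v k * M k l * v l))"

text \<open>
  The lifted set for \<open>t - q/p\<close> of order \<open>N\<close>. Only the entries \<open>y\<^sub>\<alpha>\<close> with \<open>\<alpha> \<le> 2N - deg p\<close> and
  \<open>z\<^sub>\<beta>\<close> with \<open>\<beta> < deg p\<close> are constrained or used.
\<close>

definition R_qmod_lift ::
    "real set \<Rightarrow> real poly \<Rightarrow> real poly \<Rightarrow> nat \<Rightarrow> ((nat \<Rightarrow> real) \<times> (nat \<Rightarrow> real) \<times> real) set" where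
  "R_qmod_lift I q p N =
     {(y, z, t). y 0 = 1 \<and>
        0 \<le> t - (\<Sum>\<alpha>\<le>2 * N - degree p. coeff (q div p) \<alpha> * y \<alpha>)
              - (\<Sum>\<beta><degree p. coeff (q mod p) \<beta> * z \<beta>) \<and>
        (\<forall>i\<in>gam_idx I. psd (N - del i)
           (\<lambda>k l. (\<Sum>\<alpha>\<le>2 * N - degree p. Qmat I p i \<alpha> k l * y \<alpha>)
                + (\<Sum>\<beta><degree p. Pmat I p i \<beta> k l * z \<beta>)))}"

definition R_qmod :: "real set \<Rightarrow> real poly \<Rightarrow> real poly \<Rightarrow> nat \<Rightarrow> (real \<times> real) set" where
  "R_qmod I q p N = (\<lambda>(y, z, t). (t, y 1)) ` R_qmod_lift I q p N"


section \<open>Consistency of the encodings\<close>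

lemma poly_dehom: "poly (dehom G) s = eval2 G (1, s)"
  unfolding dehom_def eval2_def
  by (induction G) (simp_all add: map_poly_pCons)

lemma eval2_sum:
  "eval2 G x = (\<Sum>j\<le>degree G. \<Sum>i\<le>degree (coeff G j). coeff (coeff G j) i * fst x ^ i * snd x ^ j)"
  unfolding eval2_def poly_altdef[of G] poly_sum
  by (simp add: poly_altdef[of "coeff G _"] poly_power sum_distrib_right)

lemma total_degree_ge:
  assumes "coeff (coeff G j) i \<noteq> 0"
  shows "i + j \<le> total_degree G"
proof -
  have "{i + j |i j. coeff (coeff G j) i \<noteq> 0}
          \<subseteq> (\<lambda>(j, i). i + j) ` (SIGMA j:{..degree G}. {..degree (coeff G j)})"
    by (force intro: le_degree)
  then have "finite {i + j |i j. coeff (coeff G j) i \<noteq> 0}"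
    by (rule finite_subset) auto
  then show ?thesis
    unfolding total_degree_def using assms by (intro Max_ge) auto
qed

lemma persp_poly_persp:
  assumes "fst x > 0"
  shows "persp_poly G (persp x) = eval2 G x / fst x ^ total_degree G"
proof -
  have "coeff (coeff G j) i * (1 / fst x) ^ (total_degree G - (i + j)) * (snd x / fst x) ^ j
      = coeff (coeff G j) i * fst x ^ i * snd x ^ j / fst x ^ total_degree G" for i j
  proof (cases "coeff (coeff G j) i = 0")
    case False
    then obtain d where "total_degree G = i + j + d"
      using total_degree_ge le_Suc_ex by blast
    then show ?thesis
      using assms by (simp add: power_divide power_add)
  qed simp
  then show ?thesis
    unfolding persp_poly_def eval2_sum persp_def by (simp add: sum_divide_distrib)
qed

lemma eval2_homogeneous:
  assumes "homogeneous k G" "fst x > 0"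
  shows "eval2 G x = fst x ^ k * poly (dehom G) (snd x / fst x)"
proof -
  have eq: "coeff (coeff G j) i * fst x ^ i * snd x ^ j
      = fst x ^ k * (coeff (coeff G j) i * (snd x / fst x) ^ j)" for i j
  proof (cases "coeff (coeff G j) i = 0")
    case False
    then have "k = i + j"
      using assms(1) by (auto simp: homogeneous_def)
    then show ?thesis
      using assms(2) by (simp add: power_divide power_add)
  qed simp
  then show ?thesis
    unfolding poly_dehom eval2_sum sum_distrib_left eq by simp
qed

lemma persp_image:
  assumes "homogeneous b fb" "homogeneous (b + 1) fb1"
  shows "persp_S (persp_dom m g) fb fb1
           = persp ` {x \<in> S_set (dom_set m g) (fb - fb1). 0 < fst x}"
proof -
  have *: "persp x \<in> persp_S (persp_dom m g) fb fb1 \<longleftrightarrow> x \<in> S_set (dom_set m g) (fb - fb1)"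
    if x: "0 < fst x" for x
  proof -
    have "eval2 (fb - fb1) x = fst x ^ b * persp_fun fb fb1 (persp x)"
      using eval2_homogeneous[OF assms(1) x] eval2_homogeneous[OF assms(2) x] x
      unfolding persp_fun_def persp_def by (simp add: eval2_def algebra_simps)
    then have "0 \<le> eval2 (fb - fb1) x \<longleftrightarrow> 0 \<le> persp_fun fb fb1 (persp x)"
      using x by (simp add: zero_le_mult_iff not_le[symmetric])
        (metis not_le order_less_imp_le x zero_less_power)
    moreover have "0 \<le> persp_poly G (persp x) \<longleftrightarrow> 0 \<le> eval2 G x" for G
      using x by (simp add: persp_poly_persp pos_le_divide_eq)
    moreover have "0 < fst (persp x)"
      using x by (simp add: persp_def)
    ultimately show ?thesis
      unfolding persp_S_def S_set_def persp_dom_def dom_set_def by simp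
  qed
  have inv: "persp (persp x) = x" if "0 < fst x" for x
    using that by (simp add: persp_def)
  have pos: "0 < fst (persp x)" if "0 < fst x" for x
    using that by (simp add: persp_def)
  show ?thesis
  proof (intro set_eqI iffI)
    fix w assume w: "w \<in> persp_S (persp_dom m g) fb fb1"
    then have p: "0 < fst w" by (simp add: persp_S_def)
    then show "w \<in> persp ` {x \<in> S_set (dom_set m g) (fb - fb1). 0 < fst x}"
      using w *[of "persp w"] inv[OF p] pos[OF p] by (intro image_eqI[of _ _ "persp w"]) auto
  qed (use * in auto)
qed

end

theory Submission
  imports Defs "HOL-Computational_Algebra.Fundamental_Theorem_Algebra"
begin

text \<open>
  Write \<open>E\<close> for the transformed set. The map \<open>(x\<^sub>1, x\<^sub>2) \<mapsto> (1/x\<^sub>1, x\<^sub>2/x\<^sub>1)\<close> is projective, so it carries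
  the convex set \<open>S \<inter> {x\<^sub>1 > 0}\<close> to a convex set: \<open>E\<close> is convex (\<open>convex_persp_image\<close>). It is also an
  epigraph that lies in the open half-plane \<open>t > 0\<close> and is relatively closed there. A point \<open>(0, s)\<close>
  of its closure would have the whole ray above it in \<open>E\<close>, hence would itself lie in the epigraph \<open>E\<close>,
  which is impossible; so \<open>E\<close> is closed (\<open>closed_rat_epigraph_halfplane\<close>).

  A lifted point \<open>(y, z)\<close> determines a linear functional \<open>L\<close> on polynomials, to be thought of
  as \<open>r \<mapsto> \<integral> r / p\<close>: it satisfies \<open>L p = y\<^sub>0 = 1\<close> and \<open>L (s p) = y\<^sub>1\<close>, and the semidefinite
  constraints say that \<open>L\<close> is nonnegative on the truncated quadratic module generated by the
  \<open>\<gamma>\<^sub>i\<close>. For a point \<open>(t, s)\<close> of \<open>E\<close> with \<open>p s > 0\<close>, evaluation \<open>r \<mapsto> r s / p s\<close> is such a functional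
  (\<open>epigraph_point_in_R_qmod\<close>). The case \<open>p s = 0\<close> does not arise: points of \<open>E\<close> near \<open>(t, s)\<close> have
  \<open>0 < q/p\<close> bounded by their height, so \<open>q s\<close> would vanish together with \<open>p s\<close>,
  against the absence of common zeros.

  Conversely, a point \<open>(t, y\<^sub>1)\<close> of the projection outside the closed convex set \<open>E\<close> is cut off by
  some \<open>a\<^sub>1 t + a\<^sub>2 s \<ge> c\<close> valid on \<open>E\<close>. As \<open>E\<close> is an epigraph, \<open>a\<^sub>1 \<ge> 0\<close> and the
  polynomial \<open>a\<^sub>1 q + (a\<^sub>2 s - c) p\<close> is nonnegative on the interval. Every polynomial of degree at most
  \<open>N\<close> that is nonnegative on an interval with nonempty interior belongs to the quadratic module truncated at \<open>N\<close>
  (\<open>nonneg_imp_trunc_qmod\<close>), so applying \<open>L\<close> yields \<open>a\<^sub>1 t + a\<^sub>2 y\<^sub>1 \<ge> c\<close>, a contradiction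
  (\<open>R_qmod_subset_closed_convex\<close>). The degree of the polynomial depends only on \<open>p\<close> and \<open>q\<close>, which
  makes one order \<open>N\<close> serve for all separating lines.
\<close>

section \<open>Nonnegative polynomials on an interval\<close>

text \<open>
  The degree condition is written with a sum because \<open>N - del i\<close> would be truncated at \<open>N = 0\<close> and
  admit constant multiples of the linear generators; multiplication by a generator would then
  no longer raise the order by just one.
\<close>

inductive_set trunc_qmod :: "real set \<Rightarrow> nat \<Rightarrow> real poly set" for I N where
  gen: "i \<in> gam_idx I \<Longrightarrow> degree v + del i \<le> N \<Longrightarrow> gam I i * v\<^sup>2 \<in> trunc_qmod I N"
| add: "r \<in> trunc_qmod I N \<Longrightarrow> r' \<in> trunc_qmod I N \<Longrightarrow> r + r' \<in> trunc_qmod I N"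

lemma trunc_qmod_mono: "r \<in> trunc_qmod I M \<Longrightarrow> M \<le> N \<Longrightarrow> r \<in> trunc_qmod I N"
  by (induction rule: trunc_qmod.induct) (auto intro: trunc_qmod.intros)

lemma trunc_qmod_const:
  assumes "0 \<le> c"
  shows "[:c:] \<in> trunc_qmod I N"
proof -
  have "gam I 0 * [:sqrt c:]\<^sup>2 \<in> trunc_qmod I N"
    by (rule trunc_qmod.gen) (auto simp: gam_idx_def del_def)
  moreover have "gam I 0 * [:sqrt c:]\<^sup>2 = [:c:]"
    using assms by (simp add: gam_def power2_eq_square)
  ultimately show ?thesis by simp
qed

lemma trunc_qmod_mult_square:
  assumes "r \<in> trunc_qmod I N"
  shows "w\<^sup>2 * r \<in> trunc_qmod I (N + degree w)"
  using assms
proof (induction rule: trunc_qmod.induct)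
  case (gen i v)
  have "degree (w * v) + del i \<le> N + degree w"
    using degree_mult_le[of w v] gen(2) by linarith
  from trunc_qmod.gen[OF gen(1) this] show ?case
    by (simp add: power_mult_distrib ac_simps)
next
  case (add r r')
  then show ?case by (simp add: distrib_left trunc_qmod.add)
qed

lemma degree_gam: "i \<noteq> 0 \<Longrightarrow> degree (gam I i) = 1"
  by (simp add: gam_def)

text \<open>
  This is where the quadratic module of a compact interval absorbs the preordering: with
  \<open>\<gamma>\<^sub>1 + \<gamma>\<^sub>2\<close> equal to the length of the interval, \<open>\<gamma>\<^sub>1 \<gamma>\<^sub>2\<close> is a positive multiple of
  \<open>\<gamma>\<^sub>2 \<gamma>\<^sub>1\<^sup>2 + \<gamma>\<^sub>1 \<gamma>\<^sub>2\<^sup>2\<close>.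
\<close>

lemma trunc_qmod_mult_endpoints:
  assumes idx: "1 \<in> gam_idx I" "2 \<in> gam_idx I" and len: "Inf I < Sup I"
    and deg: "degree v + 1 \<le> N"
  shows "gam I 1 * (gam I 2 * v\<^sup>2) \<in> trunc_qmod I (N + 1)"
proof -
  define c where "c = 1 / sqrt (Sup I - Inf I)"
  have c: "c\<^sup>2 * (Sup I - Inf I) = 1"
    using len by (simp add: c_def power_divide)
  have d: "degree (smult c (gam I i * v)) + del j \<le> N + 1"
    if "i \<noteq> 0" "j \<noteq> 0" for i j
    using degree_mult_le[of "gam I i" v] degree_smult_le[of c "gam I i * v"] degree_gam[of i I] that deg
    by (simp add: del_def)
  have "gam I 2 * (smult c (gam I 1 * v))\<^sup>2 + gam I 1 * (smult c (gam I 2 * v))\<^sup>2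
          \<in> trunc_qmod I (N + 1)"
    by (intro trunc_qmod.add trunc_qmod.gen idx d) auto
  moreover have "gam I 2 * (smult c (gam I 1 * v))\<^sup>2 + gam I 1 * (smult c (gam I 2 * v))\<^sup>2
      = smult (c\<^sup>2) (gam I 1 + gam I 2) * (gam I 1 * (gam I 2 * v\<^sup>2))"
    by (simp add: power2_eq_square algebra_simps smult_add_right)
  moreover have "smult (c\<^sup>2) (gam I 1 + gam I 2) = 1"
    using c by (simp add: gam_def)
  ultimately show ?thesis by (simp only: mult_1)
qed

lemma Inf_less_Sup_interior:
  fixes I :: "real set"
  assumes "interior I \<noteq> {}" "bdd_below I" "bdd_above I"
  shows "Inf I < Sup I"
proof -
  obtain s e where e: "0 < e" "cball s e \<subseteq> I"
    using assms(1) by (meson ex_in_conv mem_interior_cball)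
  then have "s \<in> I" "s + e \<in> I" by (auto simp: dist_real_def subset_iff)
  then have "Inf I \<le> s" "s + e \<le> Sup I" using assms(2,3) by (auto intro: cInf_lower cSup_upper)
  with e(1) show ?thesis by simp
qed

lemma trunc_qmod_mult_gam:
  assumes i: "i \<in> gam_idx I" "i \<noteq> 0" and int: "interior I \<noteq> {}"
    and r: "r \<in> trunc_qmod I N"
  shows "gam I i * r \<in> trunc_qmod I (N + 1)"
  using r
proof (induction rule: trunc_qmod.induct)
  case (gen j v)
  have ij: "i = 1 \<or> i = 2" "j = 0 \<or> j = 1 \<or> j = 2"
    using i gen(1) by (auto simp: gam_idx_def split: if_splits)
  consider "j = 0" | "j = i" | "j \<noteq> 0" "j \<noteq> i" by blast
  then show ?case
  proof cases
    case 1
    then have "gam I i * v\<^sup>2 \<in> trunc_qmod I (N + 1)"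
      using gen(2) i by (intro trunc_qmod.gen) (auto simp: del_def)
    with 1 show ?thesis by (simp add: gam_def)
  next
    case 2
    have "gam I 0 * (gam I i * v)\<^sup>2 \<in> trunc_qmod I (N + 1)"
      using gen(2) degree_mult_le[of "gam I i" v] degree_gam[of i I] i 2
      by (intro trunc_qmod.gen) (auto simp: del_def gam_idx_def)
    with 2 show ?thesis by (simp add: gam_def[of I 0] power2_eq_square ac_simps)
  next
    case 3
    then have "degree v + 1 \<le> N" using gen(2) by (simp add: del_def)
    moreover have idx: "1 \<in> gam_idx I" "2 \<in> gam_idx I"
      using ij 3 i gen(1) by auto
    moreover have "Inf I < Sup I"
      using idx by (intro Inf_less_Sup_interior int) (auto simp: gam_idx_def split: if_splits)
    ultimately have "gam I 1 * (gam I 2 * v\<^sup>2) \<in> trunc_qmod I (N + 1)"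
      by (intro trunc_qmod_mult_endpoints)
    moreover have "gam I i * (gam I j * v\<^sup>2) = gam I 1 * (gam I 2 * v\<^sup>2)"
      using ij 3 i by (auto simp: mult.left_commute)
    ultimately show ?thesis by (simp only:)
  qed
next
  case (add r r')
  then show ?case by (simp add: distrib_left trunc_qmod.add)
qed

text \<open>
  A finite exceptional set is allowed, because cofactors of a root factor and the ratio \<open>q/p\<close> are
  controlled only away from finitely many points.
\<close>

lemma poly_nonneg_closure:
  fixes r :: "real poly"
  assumes U: "open U" and F: "finite F"
    and nonneg: "\<And>s. s \<in> U \<Longrightarrow> s \<notin> F \<Longrightarrow> 0 \<le> poly r s"
    and s: "s \<in> closure U"
  shows "0 \<le> poly r s"
proof -
  let ?W = "U \<inter> {s. poly r s < 0}"
  have "open ?W"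
    by (intro open_Int U open_Collect_less continuous_intros)
  moreover have "finite ?W"
    using nonneg by (intro finite_subset[OF _ F]) force
  ultimately have "?W = {}"
    using finite_imp_not_open by blast
  then have "U \<subseteq> {s. 0 \<le> poly r s}" by force
  moreover have "closed {s. 0 \<le> poly r s}"
    by (intro closed_Collect_le continuous_intros)
  ultimately show ?thesis
    using s closure_minimal by blast
qed

text \<open>
  On an unbounded set the minimum is still attained, since a nonconstant polynomial that is
  nonnegative there must tend to infinity.
\<close>

lemma poly_attains_inf:
  fixes r :: "real poly"
  assumes J: "closed J" "J \<noteq> {}" and nonneg: "\<And>s. s \<in> J \<Longrightarrow> 0 \<le> poly r s"
  shows "\<exists>c\<in>J. \<forall>s\<in>J. poly r c \<le> poly r s"
proof (cases "degree r = 0")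
  case True
  then obtain m where "r = [:m:]" by (meson degree_eq_zeroE)
  with J show ?thesis by auto
next
  case False
  obtain s0 where s0: "s0 \<in> J" using J by blast
  obtain a r' where r: "r = pCons a r'" by (cases r)
  with False have "r' \<noteq> 0" by auto
  then obtain B where B: "\<And>s. B \<le> norm s \<Longrightarrow> poly r s0 \<le> norm (poly r s)"
    using poly_infinity[of r' "poly r s0" a] r by blast
  \<comment> \<open>The maximum makes \<open>s0\<close> a member of the compact set, so its minimum is at most \<open>poly r s0\<close>.\<close>
  let ?K = "J \<inter> cball 0 (max B \<bar>s0\<bar>)"
  have "\<exists>c\<in>?K. \<forall>s\<in>?K. poly r c \<le> poly r s"
    using s0 J by (intro continuous_attains_inf closed_Int_compact continuous_intros) auto
  then obtain c where c: "c \<in> ?K" "\<And>s. s \<in> ?K \<Longrightarrow> poly r c \<le> poly r s" by blast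
  have "poly r c \<le> poly r s" if s: "s \<in> J" for s
  proof (cases "s \<in> ?K")
    case False
    then have "poly r s0 \<le> poly r s" using s B[of s] nonneg[OF s] by auto
    moreover have "poly r c \<le> poly r s0" using s0 by (intro c(2)) auto
    ultimately show ?thesis by simp
  qed (use c in blast)
  then show ?thesis using c(1) by blast
qed

lemma poly_double_root_at_min:
  fixes r :: "real poly"
  assumes c: "c \<in> interior I" and min: "\<And>s. s \<in> interior I \<Longrightarrow> m \<le> poly r s"
    and m: "poly r c = m"
  obtains w where "r = [:m:] + [:- c, 1:]\<^sup>2 * w"
proof -
  have "poly (r - [:m:]) c = 0" using m by simp
  then obtain u where "r - [:m:] = [:- c, 1:] * u"
    by (meson dvdE poly_eq_0_iff_dvd)
  then have r: "r = [:m:] + [:- c, 1:] * u" by (metis add.commute diff_add_cancel)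
  obtain e where e: "e > 0" "ball c e \<subseteq> interior I"
    using c openE open_interior by blast
  have "poly (pderiv r) c = 0"
    using e min m by (intro DERIV_local_min[OF poly_DERIV e(1)]) (auto simp: dist_real_def)
  then have "poly u c = 0"
    by (simp add: r pderiv_add pderiv_diff pderiv_smult pderiv_pCons)
  then obtain w where "u = [:- c, 1:] * w"
    by (meson dvdE poly_eq_0_iff_dvd)
  with r have "r = [:m:] + [:- c, 1:]\<^sup>2 * w"
    by (simp only: power2_eq_square mult.assoc)
  then show ?thesis by (rule that)
qed

lemma gam_nonneg: "i \<in> gam_idx I \<Longrightarrow> s \<in> I \<Longrightarrow> 0 \<le> poly (gam I i) s"
  by (auto simp: gam_idx_def gam_def cInf_lower cSup_upper split: if_splits)

text \<open>
  For a point of the closure outside the interior, convexity forces the whole interval to lie on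
  one side of it, so the point is a finite endpoint and the corresponding generator is a root
  factor at it.
\<close>

lemma interval_boundary_gam:
  assumes I: "is_interval I" and c: "c \<in> closure I" "c \<notin> interior I"
  obtains i where "i \<in> gam_idx I" "i \<noteq> 0" "poly (gam I i) c = 0"
proof -
  have I0: "I \<noteq> {}" using c by auto
  have "\<not> (\<exists>x\<in>I. \<exists>y\<in>I. x < c \<and> c < y)"
  proof
    assume "\<exists>x\<in>I. \<exists>y\<in>I. x < c \<and> c < y"
    then obtain x y where xy: "x \<in> I" "y \<in> I" "x < c" "c < y" by blast
    then have "{x<..<y} \<subseteq> I"
      using mem_is_interval_1_I[OF I xy(1,2)] by force
    with xy(3,4) have "c \<in> interior I" by (intro interiorI[of "{x<..<y}"]) simp_all
    with c show False by blast
  qed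
  then consider "\<And>x. x \<in> I \<Longrightarrow> c \<le> x" | "\<And>x. x \<in> I \<Longrightarrow> x \<le> c"
    by (meson linorder_not_le)
  then show ?thesis
  proof cases
    case 1
    then have bdd: "bdd_below I" by (auto simp: bdd_below_def)
    have "I \<subseteq> {Inf I..}" using bdd by (auto intro: cInf_lower)
    then have "closure I \<subseteq> {Inf I..}" by (rule closure_minimal) simp
    with c(1) have "Inf I \<le> c" by blast
    then have "Inf I = c" using cInf_greatest[OF I0 1] by (rule antisym)
    with bdd show ?thesis by (intro that[of 1]) (simp_all add: gam_idx_def gam_def)
  next
    case 2
    then have bdd: "bdd_above I" by (auto simp: bdd_above_def)
    have "I \<subseteq> {..Sup I}" using bdd by (auto intro: cSup_upper)
    then have "closure I \<subseteq> {..Sup I}" by (rule closure_minimal) simp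
    with c(1) have "c \<le> Sup I" by blast
    with cSup_least[OF I0 2] have "Sup I = c" by (rule antisym)
    with bdd show ?thesis by (intro that[of 2]) (simp_all add: gam_idx_def gam_def)
  qed
qed

text \<open>
  Induction on the degree. Subtracting the minimum \<open>m \<ge> 0\<close> over the closed interval leaves a
  nonnegative polynomial with a root \<open>c\<close> in the interval. At an interior point the root is double and
  \<open>(s - c)\<^sup>2\<close> splits off; at an endpoint the generator \<open>\<gamma>\<^sub>i\<close> vanishing there splits off. The cofactor is again
  nonnegative and has smaller degree, and multiplication by the split factor raises the order by
  at most the degree of that factor, so the order never exceeds the degree. Shifting by the
  minimum makes positive polynomials without real roots no special case.
\<close>

lemma nonneg_imp_trunc_qmod:
  assumes I: "is_interval I" and int: "interior I \<noteq> {}"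
    and nonneg: "\<And>s. s \<in> interior I \<Longrightarrow> 0 \<le> poly r s"
    and deg: "degree r \<le> d"
  shows "r \<in> trunc_qmod I d"
proof -
  have cl: "closure (interior I) = closure I"
    using I int by (simp add: convex_closure_interior is_interval_convex_1)
  from nonneg deg show ?thesis
  proof (induction d arbitrary: r rule: less_induct)
    case (less d)
    have nn: "0 \<le> poly r s" if "s \<in> closure I" for s
      using that less.prems(1) by - (rule poly_nonneg_closure[of "interior I" "{}"], simp_all add: cl)
    have ne: "closure I \<noteq> {}"
      using int by (metis closure_eq_empty interior_empty)
    obtain c where c: "c \<in> closure I" "\<And>s. s \<in> closure I \<Longrightarrow> poly r c \<le> poly r s"
      using poly_attains_inf[OF closed_closure ne nn] by blast
    define m where "m = poly r c"
    have m: "0 \<le> m" unfolding m_def by (rule nn[OF c(1)])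
    have min: "m \<le> poly r s" if "s \<in> interior I" for s
      unfolding m_def using c(2) that interior_subset[of I] closure_subset[of I] by blast
    have const: "[:m:] \<in> trunc_qmod I d" using m by (rule trunc_qmod_const)
    show ?case
    proof (cases "c \<in> interior I")
      case True
      obtain w where w: "r = [:m:] + [:- c, 1:]\<^sup>2 * w"
        by (rule poly_double_root_at_min[OF True min m_def[symmetric]])
      show ?thesis
      proof (cases "w = 0")
        case True
        with w const show ?thesis by simp
      next
        case False
        have "degree ([:- c, 1:]\<^sup>2 * w) = 2 + degree w"
          using False by (simp add: degree_mult_eq degree_power_eq)
        moreover have "degree ([:- c, 1:]\<^sup>2 * w) \<le> d"
        proof -
          have "[:- c, 1:]\<^sup>2 * w = r - [:m:]" by (simp add: w)
          then show ?thesis using less.prems(2) by (simp add: degree_diff_le)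
        qed
        ultimately have dw: "degree w + 2 \<le> d" by simp
        have "0 \<le> poly w s" if "s \<in> interior I" "s \<notin> {c}" for s
        proof -
          have "poly r s = m + (s - c)\<^sup>2 * poly w s"
            by (simp add: w)
          then have "0 \<le> (s - c)\<^sup>2 * poly w s" using min[OF that(1)] by simp
          then show ?thesis using that(2) by (simp add: zero_le_mult_iff)
        qed
        then have "0 \<le> poly w s" if "s \<in> interior I" for s
          using that closure_subset by - (rule poly_nonneg_closure[of "interior I" "{c}"], auto)
        then have "w \<in> trunc_qmod I (d - 2)"
          using dw by (intro less.IH) auto
        then have "[:- c, 1:]\<^sup>2 * w \<in> trunc_qmod I (d - 2 + 1)"
          using trunc_qmod_mult_square[of w I "d - 2" "[:- c, 1:]"] by simp
        then have "[:- c, 1:]\<^sup>2 * w \<in> trunc_qmod I d"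
          using dw by (elim trunc_qmod_mono) auto
        with w const show ?thesis by (simp add: trunc_qmod.add)
      qed
    next
      case False
      obtain i where i: "i \<in> gam_idx I" "i \<noteq> 0" "poly (gam I i) c = 0"
        by (rule interval_boundary_gam[OF I c(1) False])
      have "gam I i dvd [:- c, 1:]"
      proof (cases "i = 1")
        case True
        with i(3) show ?thesis by (simp add: gam_def)
      next
        case False
        with i(2,3) have "gam I i = - [:- c, 1:]" by (simp add: gam_def)
        then show ?thesis by (simp only: minus_dvd_iff dvd_refl)
      qed
      moreover have "[:- c, 1:] dvd r - [:m:]"
        by (simp add: m_def flip: poly_eq_0_iff_dvd)
      ultimately have "gam I i dvd r - [:m:]" by (rule dvd_trans)
      then obtain w where "r - [:m:] = gam I i * w" by (rule dvdE)
      then have w: "r = [:m:] + gam I i * w" by (simp only: diff_eq_eq add.commute)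
      show ?thesis
      proof (cases "w = 0")
        case True
        with w const show ?thesis by simp
      next
        case False
        have "degree (gam I i * w) = 1 + degree w"
          using False degree_gam[OF i(2), of I] by (subst degree_mult_eq) auto
        moreover have "degree (gam I i * w) \<le> d"
        proof -
          have "gam I i * w = r - [:m:]" by (simp add: w)
          then show ?thesis using less.prems(2) by (simp add: degree_diff_le)
        qed
        ultimately have dw: "degree w + 1 \<le> d" by simp
        have "0 \<le> poly w s" if "s \<in> interior I" "s \<notin> {c}" for s
        proof -
          have "poly r s = m + poly (gam I i) s * poly w s"
            by (simp add: w)
          then have "0 \<le> poly (gam I i) s * poly w s" using min[OF that(1)] by simp
          moreover have "0 \<le> poly (gam I i) s"
            using gam_nonneg[OF i(1)] that(1) interior_subset by blast
          moreover have "poly (gam I i) s \<noteq> 0"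
            using i that(2) by (auto simp: gam_def split: if_splits)
          ultimately show ?thesis by (simp add: zero_le_mult_iff)
        qed
        then have "0 \<le> poly w s" if "s \<in> interior I" for s
          using that closure_subset by - (rule poly_nonneg_closure[of "interior I" "{c}"], auto)
        then have "w \<in> trunc_qmod I (d - 1)"
          using dw by (intro less.IH) auto
        then have "gam I i * w \<in> trunc_qmod I d"
          using trunc_qmod_mult_gam[OF i(1,2) int, of w "d - 1"] dw by simp
        with w const show ?thesis by (simp add: trunc_qmod.add)
      qed
    qed
  qed
qed

section \<open>The linear functional of a lifted point\<close>

text \<open>
  The Riesz functional of \<open>(y, z)\<close>: \<open>r/p\<close> is expanded in the functions \<open>s\<^sup>\<alpha>\<close> and \<open>s\<^sup>\<beta>/p\<close>, which are then
  replaced by the lifting variables. It is linear on all polynomials, although it ignores the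
  quotient coefficients beyond \<open>2N - deg p\<close>.
\<close>

definition riesz :: "nat \<Rightarrow> real poly \<Rightarrow> (nat \<Rightarrow> real) \<Rightarrow> (nat \<Rightarrow> real) \<Rightarrow> real poly \<Rightarrow> real" where
  "riesz N p y z r = (\<Sum>\<alpha>\<le>2 * N - degree p. coeff (r div p) \<alpha> * y \<alpha>)
                   + (\<Sum>\<beta><degree p. coeff (r mod p) \<beta> * z \<beta>)"

lemma riesz_add: "riesz N p y z (r + r') = riesz N p y z r + riesz N p y z r'"
  by (simp add: riesz_def poly_div_add_left poly_mod_add_left distrib_right sum.distrib)

lemma riesz_smult: "riesz N p y z (smult c r) = c * riesz N p y z r"
  by (simp add: riesz_def div_smult_left mod_smult_left sum_distrib_left distrib_left mult.assoc)

lemma riesz_sum: "riesz N p y z (\<Sum>k\<in>A. r k) = (\<Sum>k\<in>A. riesz N p y z (r k))"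
proof (induction A rule: infinite_finite_induct)
  case (insert k A)
  then show ?case by (simp add: riesz_add)
qed (simp_all add: riesz_def)

lemma riesz_denominator:
  assumes "p \<noteq> 0" "degree p + 1 \<le> 2 * N"
  shows "riesz N p y z p = y 0" "riesz N p y z ([:0, 1:] * p) = y 1"
proof -
  have "(\<Sum>\<alpha>\<le>2 * N - degree p. coeff (monom 1 k) \<alpha> * y \<alpha>) = y k" if "k \<le> 1" for k
  proof -
    have "(\<Sum>\<alpha>\<le>2 * N - degree p. coeff (monom 1 k) \<alpha> * y \<alpha>)
        = (\<Sum>\<alpha>\<le>2 * N - degree p. if \<alpha> = k then y \<alpha> else 0)"
      by (intro sum.cong) auto
    then show ?thesis using assms that by simp
  qed
  from this[of 0] this[of 1] show "riesz N p y z p = y 0" "riesz N p y z ([:0, 1:] * p) = y 1"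
    using assms by (simp_all add: riesz_def monom_0 monom_Suc del: mult_pCons_left coeff_monom)
qed

text \<open>
  The matrix of the semidefinite constraint for \<open>\<gamma>\<^sub>i\<close> is the Gram matrix of the quadratic form
  \<open>v \<mapsto> L (\<gamma>\<^sub>i v\<^sup>2)\<close> in the monomial basis.
\<close>

lemma riesz_localizing:
  assumes "degree v \<le> n"
  shows "riesz N p y z (gam I i * v\<^sup>2)
      = (\<Sum>k\<le>n. \<Sum>l\<le>n. coeff v k *
          ((\<Sum>\<alpha>\<le>2 * N - degree p. Qmat I p i \<alpha> k l * y \<alpha>)
             + (\<Sum>\<beta><degree p. Pmat I p i \<beta> k l * z \<beta>)) * coeff v l)"
proof -
  have "v\<^sup>2 = (\<Sum>k\<le>n. monom (coeff v k) k) * (\<Sum>l\<le>n. monom (coeff v l) l)"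
    using assms by (simp add: poly_as_sum_of_monoms' power2_eq_square)
  also have "\<dots> = (\<Sum>k\<le>n. \<Sum>l\<le>n. smult (coeff v k * coeff v l) (monom 1 (k + l)))"
    by (simp add: sum_product mult_monom smult_monom)
  finally have "gam I i * v\<^sup>2
      = (\<Sum>k\<le>n. \<Sum>l\<le>n. smult (coeff v k * coeff v l) (gam I i * monom 1 (k + l)))"
    by (simp add: sum_distrib_left)
  then have "riesz N p y z (gam I i * v\<^sup>2)
      = (\<Sum>k\<le>n. \<Sum>l\<le>n. coeff v k * coeff v l * riesz N p y z (gam I i * monom 1 (k + l)))"
    by (simp only: riesz_sum riesz_smult)
  then show ?thesis
    by (simp add: riesz_def Qmat_def Pmat_def ac_simps)
qed

lemma riesz_nonneg:
  assumes psd: "\<And>i. i \<in> gam_idx I \<Longrightarrow> psd (N - del i)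
           (\<lambda>k l. (\<Sum>\<alpha>\<le>2 * N - degree p. Qmat I p i \<alpha> k l * y \<alpha>)
                + (\<Sum>\<beta><degree p. Pmat I p i \<beta> k l * z \<beta>))"
    and r: "r \<in> trunc_qmod I N"
  shows "0 \<le> riesz N p y z r"
  using r
proof (induction rule: trunc_qmod.induct)
  case (gen i v)
  then have "degree v \<le> N - del i" by simp
  from riesz_localizing[OF this] psd[OF gen(1)] show ?case
    by (simp add: psd_def)
qed (simp add: riesz_add)

lemma poly_eq_sum_atMost:
  fixes r :: "real poly"
  assumes "degree r \<le> n"
  shows "poly r s = (\<Sum>i\<le>n. coeff r i * s ^ i)"
proof -
  have "poly r s = poly (\<Sum>i\<le>n. monom (coeff r i) i) s"
    by (simp only: poly_as_sum_of_monoms'[OF assms])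
  then show ?thesis by (simp add: poly_sum poly_monom)
qed

lemma degree_div_le:
  fixes p r :: "real poly"
  assumes "p \<noteq> 0"
  shows "degree (r div p) \<le> degree r - degree p"
proof (cases "degree r < degree p \<or> r div p = 0")
  case True
  then show ?thesis by (auto simp: div_poly_less)
next
  case False
  have "degree (r div p) + degree p = degree (r div p * p)"
    using False assms by (simp add: degree_mult_eq)
  also have "r div p * p = r - r mod p" by (simp add: minus_mod_eq_div_mult)
  also have "degree (r - r mod p) \<le> degree r"
    using degree_mod_less[OF assms, of r] False by (intro degree_diff_le) auto
  finally show ?thesis by simp
qed

lemma riesz_eval:
  assumes p: "poly p s \<noteq> 0" "p \<noteq> 0" and deg: "degree r \<le> 2 * N"
  shows "riesz N p (\<lambda>\<alpha>. s ^ \<alpha>) (\<lambda>\<beta>. s ^ \<beta> / poly p s) r = poly r s / poly p s"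
proof -
  have "degree (r div p) \<le> 2 * N - degree p"
    using degree_div_le[OF p(2), of r] deg by linarith
  then have "(\<Sum>\<alpha>\<le>2 * N - degree p. coeff (r div p) \<alpha> * s ^ \<alpha>) = poly (r div p) s"
    by (simp add: poly_eq_sum_atMost)
  moreover have "(\<Sum>\<beta><degree p. coeff (r mod p) \<beta> * (s ^ \<beta> / poly p s)) = poly (r mod p) s / poly p s"
  proof (cases "degree p = 0")
    case True
    with p have "r mod p = 0"
      by (metis dvd_imp_mod_0 is_unit_iff_degree unit_imp_dvd)
    with True show ?thesis by simp
  next
    case False
    then have "degree (r mod p) < degree p"
      using degree_mod_less' p(2) by (cases "r mod p = 0") auto
    then have "poly (r mod p) s = (\<Sum>\<beta>\<le>degree p - 1. coeff (r mod p) \<beta> * s ^ \<beta>)"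
      by (intro poly_eq_sum_atMost) simp
    also have "{..degree p - 1} = {..<degree p}" using False by auto
    finally show ?thesis by (simp add: sum_divide_distrib)
  qed
  moreover have "poly r s = poly (r div p) s * poly p s + poly (r mod p) s"
    by (metis div_mult_mod_eq poly_add poly_mult)
  ultimately show ?thesis
    using p by (simp add: riesz_def add_divide_distrib)
qed

lemma R_qmod_riesz:
  "(t, s) \<in> R_qmod I q p N \<longleftrightarrow>
     (\<exists>y z. y 0 = 1 \<and> y 1 = s \<and> riesz N p y z q \<le> t \<and>
        (\<forall>i\<in>gam_idx I. psd (N - del i)
           (\<lambda>k l. (\<Sum>\<alpha>\<le>2 * N - degree p. Qmat I p i \<alpha> k l * y \<alpha>)
                + (\<Sum>\<beta><degree p. Pmat I p i \<beta> k l * z \<beta>))))"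
proof -
  have "0 \<le> t - (\<Sum>\<alpha>\<le>2 * N - degree p. coeff (q div p) \<alpha> * y \<alpha>)
              - (\<Sum>\<beta><degree p. coeff (q mod p) \<beta> * z \<beta>) \<longleftrightarrow> riesz N p y z q \<le> t" for y z
    by (auto simp: riesz_def)
  then show ?thesis
    by (force simp: R_qmod_def R_qmod_lift_def image_iff)
qed

lemma epigraph_point_in_R_qmod:
  assumes s: "s \<in> I" and p: "0 < poly p s" "p \<noteq> 0"
    and deg: "degree q \<le> 2 * N" "0 < N" and t: "poly q s / poly p s \<le> t"
  shows "(t, s) \<in> R_qmod I q p N"
proof -
  let ?y = "\<lambda>\<alpha>. s ^ \<alpha>" and ?z = "\<lambda>\<beta>. s ^ \<beta> / poly p s"
  have "psd (N - del i)
           (\<lambda>k l. (\<Sum>\<alpha>\<le>2 * N - degree p. Qmat I p i \<alpha> k l * ?y \<alpha>)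
                + (\<Sum>\<beta><degree p. Pmat I p i \<beta> k l * ?z \<beta>))" (is "psd ?n ?M") if i: "i \<in> gam_idx I" for i
  proof -
    have M: "?M k l = poly (gam I i) s * s ^ k * s ^ l / poly p s" if "k \<le> ?n" "l \<le> ?n" for k l
    proof -
      have "degree (gam I i * monom 1 (k + l)) \<le> degree (gam I i) + (k + l)"
        using degree_mult_le[of "gam I i" "monom 1 (k + l)"] degree_monom_le[of "1::real" "k + l"] by linarith
      moreover have "degree (gam I i) \<le> del i" by (simp add: gam_def del_def)
      moreover have "del i \<le> 1" by (simp add: del_def)
      ultimately have "degree (gam I i * monom 1 (k + l)) \<le> 2 * N"
        using that deg(2) by linarith
      then have "riesz N p ?y ?z (gam I i * monom 1 (k + l)) = poly (gam I i * monom 1 (k + l)) s / poly p s"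
        using p by (intro riesz_eval) auto
      then show ?thesis
        by (simp add: riesz_def Qmat_def Pmat_def poly_monom power_add mult.assoc)
    qed
    have "(\<Sum>k\<le>?n. \<Sum>l\<le>?n. v k * ?M k l * v l)
        = poly (gam I i) s / poly p s * (\<Sum>k\<le>?n. v k * s ^ k)\<^sup>2" for v
    proof -
      have "(\<Sum>k\<le>?n. \<Sum>l\<le>?n. v k * ?M k l * v l)
          = (\<Sum>k\<le>?n. \<Sum>l\<le>?n. poly (gam I i) s / poly p s * ((v k * s ^ k) * (v l * s ^ l)))"
        by (intro sum.cong refl, subst M) auto
      then show ?thesis
        by (simp only: power2_eq_square sum_product) (simp only: sum_distrib_left)
    qed
    moreover have "0 \<le> poly (gam I i) s / poly p s"
      using gam_nonneg[OF i s] p(1) by simp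
    moreover have "?M k l = ?M l k" for k l
      by (simp add: Qmat_def Pmat_def add.commute)
    ultimately show ?thesis
      unfolding psd_def by (simp only:) (simp del: times_divide_eq_left)
  qed
  moreover have "riesz N p ?y ?z q \<le> t"
    using p deg t by (subst riesz_eval) auto
  ultimately show ?thesis
    unfolding R_qmod_riesz by (intro exI[of _ ?y] exI[of _ ?z]) auto
qed

text \<open>
  Separation: a point of the relaxation outside \<open>E\<close> would violate a linear inequality whose
  certificate in the quadratic module the Riesz functional respects. The finite set \<open>F\<close> is
  harmless, since a polynomial inequality off \<open>F\<close> extends to \<open>F\<close> by continuity.
\<close>

lemma R_qmod_subset_closed_convex:
  assumes I: "is_interval I" "interior I \<noteq> {}"
    and p: "p \<noteq> 0" "\<And>s. s \<in> interior I \<Longrightarrow> 0 < poly p s" and F: "finite F"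
    and deg: "degree p + 1 \<le> N" "degree q \<le> N"
    and E: "closed E" "convex E"
    and E_up: "\<And>s t. s \<in> interior I \<Longrightarrow> s \<notin> F \<Longrightarrow> poly q s / poly p s \<le> t \<Longrightarrow> (t, s) \<in> E"
  shows "R_qmod I q p N \<subseteq> E"
proof
  fix w assume w: "w \<in> R_qmod I q p N"
  obtain t s1 where ts: "w = (t, s1)" by (cases w)
  obtain y z where y: "y 0 = 1" "y 1 = s1" and q: "riesz N p y z q \<le> t"
    and psd: "\<And>i. i \<in> gam_idx I \<Longrightarrow> psd (N - del i)
           (\<lambda>k l. (\<Sum>\<alpha>\<le>2 * N - degree p. Qmat I p i \<alpha> k l * y \<alpha>)
                + (\<Sum>\<beta><degree p. Pmat I p i \<beta> k l * z \<beta>))"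
    using w unfolding ts R_qmod_riesz by blast
  show "w \<in> E"
  proof (rule ccontr)
    assume "w \<notin> E"
    then obtain a c where ac: "inner a w < c" "\<And>x. x \<in> E \<Longrightarrow> c < inner a x"
      using separating_hyperplane_closed_point[OF E(2,1)] by blast
    obtain a1 a2 where a: "a = (a1, a2)" by (cases a)
    have sep: "c < a1 * t' + a2 * s" if "s \<in> interior I" "s \<notin> F" "poly q s / poly p s \<le> t'" for s t'
      using ac(2)[OF E_up[OF that]] by (simp add: a)
    have "infinite (interior I)"
      using I(2) finite_imp_not_open open_interior by blast
    then obtain s0 where s0: "s0 \<in> interior I" "s0 \<notin> F"
      using F by (meson finite_subset subsetI)
    have a1: "0 \<le> a1"
    proof (rule ccontr)
      assume "\<not> 0 \<le> a1"
      then have neg: "a1 < 0" by simp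
      \<comment> \<open>With a negative slope in \<open>t\<close>, a high enough point of \<open>E\<close> violates the inequality.\<close>
      define t' where "t' = max (poly q s0 / poly p s0) ((c - a2 * s0) / a1)"
      have "(c - a2 * s0) / a1 \<le> t'" by (simp add: t'_def)
      then have "a1 * t' \<le> c - a2 * s0"
        using neg by (simp add: neg_divide_le_eq mult.commute)
      moreover have "c < a1 * t' + a2 * s0"
        using s0 by (intro sep) (auto simp: t'_def)
      ultimately show False by simp
    qed
    \<comment> \<open>Multiplying the separating inequality by \<open>p\<close> clears the denominator; a vertical separating
      line, \<open>a1 = 0\<close>, is covered as well.\<close>
    define r where "r = smult a1 q + (smult a2 ([:0, 1:] * p) + smult (- c) p)"
    have "0 \<le> poly r s" if "s \<in> interior I" "s \<notin> F" for s
    proof -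
      have "c < a1 * (poly q s / poly p s) + a2 * s"
        using that by (intro sep) auto
      then show ?thesis
        using p(2)[OF that(1)] by (simp add: r_def field_simps)
    qed
    then have "0 \<le> poly r s" if "s \<in> interior I" for s
      using that closure_subset F by - (rule poly_nonneg_closure[of "interior I" F], auto)
    moreover have "degree r \<le> N"
      using deg p(1) unfolding r_def
      by (intro degree_add_le order_trans[OF degree_smult_le]) (auto simp: degree_mult_eq)
    ultimately have "r \<in> trunc_qmod I N"
      by (intro nonneg_imp_trunc_qmod I) auto
    then have "0 \<le> riesz N p y z r"
      using riesz_nonneg[OF psd] by simp
    also have "riesz N p y z r = a1 * riesz N p y z q + a2 * s1 - c"
      using riesz_denominator[of p N y z] p(1) deg y by (simp only: r_def riesz_add riesz_smult) simp
    also have "\<dots> \<le> a1 * t + a2 * s1 - c"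
      using mult_left_mono[OF q a1] by simp
    also have "\<dots> < 0" using ac(1) by (simp add: a ts)
    finally show False by simp
  qed
qed

section \<open>Epigraphs of rational functions\<close>

lemma closure_upward:
  fixes C :: "(real \<times> real) set"
  assumes up: "\<And>t s t'. (t, s) \<in> C \<Longrightarrow> t \<le> t' \<Longrightarrow> (t', s) \<in> C"
    and ts: "(t, s) \<in> closure C" "t \<le> t'"
  shows "(t', s) \<in> closure C"
proof -
  have "(\<lambda>x. (t' - t, 0) + x) ` C \<subseteq> C"
    using up ts(2) by force
  then have "(\<lambda>x. (t' - t, 0) + x) ` closure C \<subseteq> closure C"
    unfolding closure_translation[symmetric] by (rule closure_mono)
  moreover have "(t', s) = (t' - t, 0) + (t, s)" by simp
  ultimately show ?thesis using ts(1) by blast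
qed

lemma rat_epigraph_upward:
  assumes "(t, s) \<in> rat_epigraph I q p" "t \<le> t'"
  shows "(t', s) \<in> rat_epigraph I q p"
proof -
  let ?C = "{(t', s'). s' \<in> interior I \<and> poly p s' \<noteq> 0 \<and> poly q s' / poly p s' \<le> t'}"
  have "(t', s) \<in> closure ?C" if "(t, s) \<in> closure ?C"
    by (rule closure_upward[OF _ that assms(2)]) auto
  then show ?thesis
    using assms by (auto simp: rat_epigraph_def)
qed

text \<open>
  The critical limit points are those on \<open>t = 0\<close>. The ray above such a point \<open>(0, s)\<close> lies in
  the epigraph, and the fibre of an epigraph over \<open>s\<close> is closed; so \<open>(0, s)\<close> belongs to
  the epigraph, contrary to \<open>t > 0\<close> there.
\<close>

lemma closed_rat_epigraph_halfplane:
  assumes pos: "\<And>t s. (t, s) \<in> rat_epigraph I q p \<Longrightarrow> 0 < t"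
    and closed_in_halfplane:
      "\<And>t s. (t, s) \<in> closure (rat_epigraph I q p) \<Longrightarrow> 0 < t \<Longrightarrow> (t, s) \<in> rat_epigraph I q p"
  shows "closed (rat_epigraph I q p)"
proof -
  let ?E = "rat_epigraph I q p"
  let ?C = "{(t', s'). s' \<in> interior I \<and> poly p s' \<noteq> 0 \<and> poly q s' / poly p s' \<le> t'}"
  have "(t, s) \<in> ?E" if ts: "(t, s) \<in> closure ?E" for t s
  proof -
    have "?E \<subseteq> {x. 0 \<le> fst x}"
    proof clarify
      fix t s assume "(t, s) \<in> ?E"
      then show "0 \<le> fst (t, s)" using pos[of t s] by simp
    qed
    moreover have "closed {x :: real \<times> real. 0 \<le> fst x}"
      by (intro closed_Collect_le continuous_intros)
    ultimately have "closure ?E \<subseteq> {x. 0 \<le> fst x}" by (rule closure_minimal)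
    with ts have "0 \<le> t" by auto
    moreover have False if "t = 0"
    proof -
      have E: "(t', s) \<in> ?E" if "0 < t'" for t'
      proof (rule closed_in_halfplane[OF _ that])
        have le: "t \<le> t'" using that \<open>t = 0\<close> by simp
        show "(t', s) \<in> closure ?E"
          by (rule closure_upward[OF _ ts le]) (rule rat_epigraph_upward)
      qed
      have "(0, s) \<in> ?E"
      proof (cases "poly p s = 0")
        case True
        have "{0<..} \<subseteq> (\<lambda>t'. (t', s)) -` closure ?C"
        proof
          fix t' :: real assume "t' \<in> {0<..}"
          then have "(t', s) \<in> ?E" by (intro E) simp
          then show "t' \<in> (\<lambda>t'. (t', s)) -` closure ?C"
            using True by (simp add: rat_epigraph_def)
        qed
        moreover have "closed ((\<lambda>t'. (t', s)) -` closure ?C)"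
          by (intro closed_vimage closed_closure continuous_intros)
        ultimately have "closure {0<..} \<subseteq> (\<lambda>t'. (t', s)) -` closure ?C"
          by (rule closure_minimal)
        then have "(0, s) \<in> closure ?C" by auto
        then show ?thesis
          using True E[of 1] by (auto simp: rat_epigraph_def)
      next
        case False
        then have "poly q s / poly p s \<le> t'" if "0 < t'" for t'
          using E[OF that] by (auto simp: rat_epigraph_def)
        then have "poly q s / poly p s \<le> 0"
          by (rule field_le_epsilon) simp
        then show ?thesis
          using False E[of 1] by (auto simp: rat_epigraph_def)
      qed
      then show False using pos by blast
    qed
    ultimately show ?thesis using closed_in_halfplane[OF ts] by fastforce
  qed
  then have "closure ?E \<subseteq> ?E" by (rule subrelI)
  then show ?thesis by (simp only: closure_subset_eq)
qed

text \<open>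
  Positivity of the heights is what rescues the endpoints at which \<open>p\<close> vanishes: it gives
  \<open>q > 0\<close> in the interior wherever \<open>p0\<close> has no zero, so that in the limit \<open>0 \<le> q s \<le> t * p s\<close>, and
  \<open>p s = 0\<close> would produce a common zero of \<open>p\<close> and \<open>q\<close>.
\<close>

lemma rat_epigraph_eq_R_qmod:
  assumes I: "is_interval I" "interior I \<noteq> {}"
    and p0: "p0 \<noteq> 0" and rep: "represents_on I q p q0 p0"
    and E: "closed (rat_epigraph I q0 p0)" "convex (rat_epigraph I q0 p0)"
    and pos: "\<And>t s. (t, s) \<in> rat_epigraph I q0 p0 \<Longrightarrow> 0 < t"
    and deg: "degree p + 1 \<le> N" "degree q \<le> N"
  shows "rat_epigraph I q0 p0 = R_qmod I q p N"
proof
  let ?E = "rat_epigraph I q0 p0"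
  let ?C = "{(t', s'). s' \<in> interior I \<and> poly p0 s' \<noteq> 0 \<and> poly q0 s' / poly p0 s' \<le> t'}"
  have p: "p \<noteq> 0" "\<And>s. s \<in> I \<Longrightarrow> 0 \<le> poly p s" "\<And>s. s \<in> interior I \<Longrightarrow> 0 < poly p s"
    and coprime: "\<And>s. s \<in> I \<Longrightarrow> poly p s = 0 \<Longrightarrow> poly q s \<noteq> 0"
    using rep by (auto simp: represents_on_def)
  have cross: "poly q s * poly p0 s = poly q0 s * poly p s" for s
    using rep unfolding represents_on_def by (metis poly_mult)
  have ratio: "poly q0 s / poly p0 s = poly q s / poly p s" if "poly p0 s \<noteq> 0" "poly p s \<noteq> 0" for s
    using cross[of s] that by (simp add: frac_eq_eq)
  have in_E: "(t, s) \<in> ?E" if "s \<in> interior I" "poly p0 s \<noteq> 0" "poly q s / poly p s \<le> t" for s t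
    using that ratio[of s] p(3)[of s] interior_subset[of I] by (auto simp: rat_epigraph_def)
  show "R_qmod I q p N \<subseteq> ?E"
  proof (rule R_qmod_subset_closed_convex[OF I p(1,3) _ deg E])
    show "finite {s. poly p0 s = 0}" using p0 by (rule poly_roots_finite)
  qed (use in_E in auto)
  show "?E \<subseteq> R_qmod I q p N"
  proof
    fix w assume "w \<in> ?E"
    then obtain t s where w: "w = (t, s)" and ts: "(t, s) \<in> ?E" by (cases w) auto
    have s: "s \<in> I" using ts by (auto simp: rat_epigraph_def)
    have "0 < poly p s \<and> poly q s / poly p s \<le> t"
    proof (cases "poly p0 s = 0")
      case False
      then have "poly p s \<noteq> 0" using cross[of s] coprime[OF s] by auto
      then show ?thesis
        using False p(2)[OF s] ratio[of s] ts by (auto simp: rat_epigraph_def)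
    next
      case True
      \<comment> \<open>Both conditions are polynomial, so they survive the limit that defines this fibre.\<close>
      have "?C \<subseteq> {x. poly q (snd x) \<le> fst x * poly p (snd x) \<and> 0 \<le> poly q (snd x)}"
      proof clarify
        fix t' s' assume *: "s' \<in> interior I" "poly p0 s' \<noteq> 0" "poly q0 s' / poly p0 s' \<le> t'"
        then have p': "0 < poly p s'" using p(3) by blast
        have "0 < poly q s' / poly p s'"
          using pos[OF in_E[OF *(1,2) order_refl]] .
        with p' have "0 \<le> poly q s'" by (simp add: zero_less_divide_iff)
        moreover have "poly q s' \<le> t' * poly p s'"
          using *(3) p' ratio[OF *(2)] by (simp add: pos_divide_le_eq)
        ultimately show "poly q (snd (t', s')) \<le> fst (t', s') * poly p (snd (t', s')) \<and>
            0 \<le> poly q (snd (t', s'))" by simp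
      qed
      moreover have "closed {x. poly q (snd x) \<le> fst x * poly p (snd x) \<and> 0 \<le> poly q (snd x)}"
        by (intro closed_Collect_conj closed_Collect_le continuous_intros)
      ultimately have "closure ?C \<subseteq> {x. poly q (snd x) \<le> fst x * poly p (snd x) \<and> 0 \<le> poly q (snd x)}"
        by (rule closure_minimal)
      moreover have "(t, s) \<in> closure ?C" using True ts by (auto simp: rat_epigraph_def)
      ultimately have q: "poly q s \<le> t * poly p s" "0 \<le> poly q s" by auto
      have "poly p s \<noteq> 0" using q coprime[OF s] by auto
      with p(2)[OF s] have "0 < poly p s" by simp
      with q(1) show ?thesis by (simp add: pos_divide_le_eq)
    qed
    then show "w \<in> R_qmod I q p N"
      unfolding w using s p(1) deg by (intro epigraph_point_in_R_qmod) auto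
  qed
qed


section \<open>The perspective transformation\<close>

text \<open>
  By homogeneity each coefficient with respect to \<open>x\<^sub>2\<close> is a monomial in \<open>x\<^sub>1\<close>, so putting \<open>x\<^sub>1 = 1\<close> cannot
  cancel anything.
\<close>

lemma dehom_nonzero:
  assumes "homogeneous k G" "G \<noteq> 0"
  shows "dehom G \<noteq> 0"
proof -
  obtain j i where ij: "coeff (coeff G j) i \<noteq> 0"
    using assms(2) by (metis coeff_0 poly_eqI)
  have "coeff G j = monom (coeff (coeff G j) i) i"
  proof (rule poly_eqI)
    fix i'
    show "coeff (coeff G j) i' = coeff (monom (coeff (coeff G j) i) i) i'"
    proof (cases "coeff (coeff G j) i' = 0")
      case False
      with assms(1) ij have "i' + j = k" "i + j = k" unfolding homogeneous_def by blast+
      then have "i' = i" by linarith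
      then show ?thesis by simp
    qed (use ij in auto)
  qed
  then have "poly (coeff G j) 1 = coeff (coeff G j) i"
    by (metis mult_1_right poly_monom power_one)
  then have "coeff (dehom G) j \<noteq> 0"
    using ij by (simp add: dehom_def coeff_map_poly)
  then show ?thesis by auto
qed

lemma persp_persp: "0 < fst x \<Longrightarrow> persp (persp x) = x"
  by (simp add: persp_def)

text \<open>
  The perspective map sends segments to segments, with changed weights: the weights \<open>u, v\<close> in
  the image correspond to weights proportional to \<open>u/x\<^sub>1\<close> and \<open>v/y\<^sub>1\<close> in the source.
\<close>

lemma convex_persp_image:
  assumes A: "convex A" and pos: "\<And>x. x \<in> A \<Longrightarrow> 0 < fst x"
  shows "convex (persp ` A)"
proof (rule convexI)
  fix w w' :: "real \<times> real" and u v :: real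
  assume "w \<in> persp ` A" "w' \<in> persp ` A" and uv: "0 \<le> u" "0 \<le> v" "u + v = 1"
  then obtain x1 x2 y1 y2 where xy: "(x1, x2) \<in> A" "(y1, y2) \<in> A"
    and w: "w = persp (x1, x2)" "w' = persp (y1, y2)" by auto
  have x1: "0 < x1" and y1: "0 < y1" using pos xy by force+
  define d where "d = u / x1 + v / y1"
  have d: "0 < d"
    using uv x1 y1 by (cases "u = 0") (auto simp: d_def add_pos_nonneg)
  let ?w = "(u / x1 / d) *\<^sub>R (x1, x2) + (v / y1 / d) *\<^sub>R (y1, y2)"
  have "?w \<in> A"
  proof (rule convexD[OF A xy])
    have "u / x1 / d + v / y1 / d = d / d" by (simp only: d_def add_divide_distrib)
    then show "u / x1 / d + v / y1 / d = 1" using d by simp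
  qed (use uv x1 y1 d in auto)
  moreover have "u / x1 / d * x1 + v / y1 / d * y1 = 1 / d"
    using x1 y1 uv(3) by (simp flip: add_divide_distrib)
  then have "?w = (1 / d, (u * (x2 / x1) + v * (y2 / y1)) / d)"
    by (simp add: add_divide_distrib ac_simps)
  then have "persp ?w = u *\<^sub>R persp (x1, x2) + v *\<^sub>R persp (y1, y2)"
    using d by (simp add: persp_def d_def)
  ultimately show "u *\<^sub>R w + v *\<^sub>R w' \<in> persp ` A"
    unfolding w by (metis imageI)
qed

lemma closed_persp_dom: "closed (persp_dom m g)"
proof -
  have "persp_dom m g = (\<Inter>i\<in>{1..m}. {x. 0 \<le> persp_poly (g i) x})"
    by (auto simp: persp_dom_def)
  moreover have "closed {x. 0 \<le> persp_poly (g i) x}" for i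
    unfolding persp_poly_def by (intro closed_Collect_le continuous_intros)
  ultimately show ?thesis by (auto intro: closed_INT)
qed

text \<open>
  For \<open>t > 0\<close> the inequality can be multiplied by \<open>t\<close>, which turns it into a polynomial
  and hence closed condition.
\<close>

lemma persp_S_closed_in_halfplane:
  assumes D: "closed D" and ts: "(t, s) \<in> closure (persp_S D fb fb1)" "0 < t"
  shows "(t, s) \<in> persp_S D fb fb1"
proof -
  let ?K = "D \<inter> {x. poly (dehom fb1) (snd x) \<le> fst x * poly (dehom fb) (snd x)}"
  have eq: "0 \<le> persp_fun fb fb1 x \<longleftrightarrow> poly (dehom fb1) (snd x) \<le> fst x * poly (dehom fb) (snd x)"
    if "0 < fst x" for x
    using that by (simp add: persp_fun_def pos_divide_le_eq mult.commute)
  then have "persp_S D fb fb1 \<subseteq> ?K" by (auto simp: persp_S_def)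
  moreover have "closed ?K"
    by (intro closed_Int D closed_Collect_le continuous_intros)
  ultimately have "(t, s) \<in> ?K" using ts(1) closure_minimal by blast
  then show ?thesis using ts(2) eq[of "(t, s)"] by (simp add: persp_S_def)
qed

text \<open>
  Two slopes \<open>x\<^sub>2/x\<^sub>1\<close> in the set are two points of the base of the epigraph, which gives the base
  interval a nonempty interior.
\<close>

lemma interior_halfplane_two_slopes:
  assumes "interior S \<noteq> {}" "S \<subseteq> {x :: real \<times> real. 0 \<le> fst x}"
  obtains x y where "x \<in> S" "y \<in> S" "0 < fst x" "0 < fst y" "snd x / fst x < snd y / fst y"
proof -
  obtain x1 x2 where "(x1, x2) \<in> interior S" using assms(1) by fast
  then obtain e where e: "0 < e" "cball (x1, x2) e \<subseteq> S"
    by (meson mem_interior_cball)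
  \<comment> \<open>The point to the left shows \<open>x1 \<ge> e\<close>; the point above has a larger slope.\<close>
  have "(x1 - e, x2) \<in> S" "(x1, x2) \<in> S" "(x1, x2 + e) \<in> S"
    using e by (auto simp: dist_Pair_Pair dist_real_def subset_iff)
  moreover from this have "0 < x1" using assms(2) e(1) by force
  ultimately show ?thesis
    using e(1) by (intro that[of "(x1, x2)" "(x1, x2 + e)"]) (auto simp: divide_strict_right_mono)
qed

theorem theorem4p4:
  fixes m b :: nat
    and g :: "nat \<Rightarrow> real poly poly"
    and f fb fb1 :: "real poly poly"
    and p q :: "real poly"
    and I :: "real set"
  assumes D_convex: "convex (dom_set m g)"
    and f_parts: "f = fb - fb1"
    and fb: "homogeneous b fb" "fb \<noteq> 0"
    and fb1: "homogeneous (b + 1) fb1" "fb1 \<noteq> 0"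
    and f_origin: "eval2 f 0 = 0"
    and f_gradient: "(eval2 f has_derivative (\<lambda>_. 0)) (at 0)"
    and S_right: "S_set (dom_set m g) f \<subseteq> {x. 0 \<le> fst x}"
    and S_interior: "interior (S_set (dom_set m g) f) \<noteq> {}"
    and S_origin: "0 \<in> S_set (dom_set m g) f"
    and I_def: "I = base_set (persp_dom m g) fb"
    and I_interval: "is_interval I"
    and epigraph: "persp_S (persp_dom m g) fb fb1 = rat_epigraph I (dehom fb1) (dehom fb)"
    and h_rep: "represents_on I q p (dehom fb1) (dehom fb)"
    and S_convex: "convex (S_set (dom_set m g) f)"
  shows "\<exists>N0. \<forall>N\<ge>N0. degree p + 1 \<le> 2 * N \<and> degree q \<le> 2 * N \<and>
           persp_S (persp_dom m g) fb fb1 = R_qmod I q p N \<and>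
           {x \<in> S_set (dom_set m g) f. 0 < fst x} = {x. 0 < fst x \<and> persp x \<in> R_qmod I q p N}"
  \<comment> \<open>This bounds the degree of \<open>a\<^sub>1 q + (a\<^sub>2 s - c) p\<close> for every separating line.\<close>
proof (intro exI[of _ "max (degree p + 1) (degree q)"] allI impI)
  fix N assume N: "max (degree p + 1) (degree q) \<le> N"
  let ?S = "S_set (dom_set m g) f" and ?E = "persp_S (persp_dom m g) fb fb1"
  have image: "?E = persp ` (?S \<inter> {x. 0 < fst x})"
    using persp_image[OF fb(1) fb1(1)] by (simp add: f_parts Collect_conj_eq)
  have "convex {x :: real \<times> real. 0 < fst x}"
    using convex_halfspace_gt[of 0 "(1, 0) :: real \<times> real"] by (simp add: inner_prod_def)
  then have "convex ?E"
    unfolding image using S_convex by (intro convex_persp_image convex_Int) auto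
  have pos: "0 < t" if "(t, s) \<in> ?E" for t s
    using that by (simp add: persp_S_def)
  have "closed ?E"
    using pos persp_S_closed_in_halfplane[OF closed_persp_dom, of _ _ m g fb fb1]
    unfolding epigraph by (rule closed_rat_epigraph_halfplane)
  obtain x y where xy: "x \<in> ?S" "y \<in> ?S" "0 < fst x" "0 < fst y" "snd x / fst x < snd y / fst y"
    using interior_halfplane_two_slopes[OF S_interior S_right] .
  then have "persp x \<in> ?E" "persp y \<in> ?E" unfolding image by auto
  then have "snd x / fst x \<in> I" "snd y / fst y \<in> I"
    unfolding epigraph by (auto simp: rat_epigraph_def persp_def)
  from mem_is_interval_1_I[OF I_interval this]
  have "{snd x / fst x<..<snd y / fst y} \<subseteq> I" by auto
  then have "{snd x / fst x<..<snd y / fst y} \<subseteq> interior I"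
    by (rule interior_maximal) simp
  moreover have "{snd x / fst x<..<snd y / fst y} \<noteq> {}"
    using xy(5) by simp
  ultimately have int: "interior I \<noteq> {}" by blast
  have eq: "?E = R_qmod I q p N"
    using \<open>closed ?E\<close> \<open>convex ?E\<close> pos N unfolding epigraph
    by (intro rat_epigraph_eq_R_qmod[OF I_interval int dehom_nonzero[OF fb] h_rep]) auto
  have "x \<in> ?S" if "0 < fst x" "persp x \<in> ?E" for x
    using that persp_persp unfolding image by (metis (no_types, lifting) IntE imageE mem_Collect_eq)
  then have "{x \<in> ?S. 0 < fst x} = {x. 0 < fst x \<and> persp x \<in> ?E}"
    unfolding image by blast
  with eq N show "degree p + 1 \<le> 2 * N \<and> degree q \<le> 2 * N \<and> ?E = R_qmod I q p N \<and>
      {x \<in> ?S. 0 < fst x} = {x. 0 < fst x \<and> persp x \<in> R_qmod I q p N}"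
    by auto
qed

end
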